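(* Let $T$ be the set of the three vertices of a (non-degenerate) triangle in the Euclidean plane that has an angle larger than $135^\circ$. Then $T$ is not diameter-Ramsey.
   Context: $\mathbb{N}$ denotes the positive integers and $\|\cdot\|$ the Euclidean norm. The diameter of a set $P \subset \mathbb{R}^d$ is $\mathrm{diam}(P) := \sup\{\|x-y\| : x,y \in P\}$. Two sets, possibly in Euclidean spaces of different dimensions, are congruent if there is a distance-preserving bijection between them. A finite set $A \subset \mathbb{R}^d$ is called diameter-Ramsey if for every $r \in \mathbb{N}$ there exist $n \in \mathbb{N}$ and a finite set $B \subset \mathbb{R}^n$ with $\mathrm{diam}(B) = \mathrm{diam}(A)$ such that whenever the points of $B$ are coloured with $r$ colours, there is a monochromatic set $A' \subset B$ (all points of $A'$ have the same colour) which is congruent to $A$. *)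

theory Defs
  imports "HOL-Analysis.Analysis"
begin

text \<open>
  The dimension of the ambient space of the set \<open>B\<close> below is existentially quantified, so it cannot
  be a type. Points of \<open>\<real>\<^sup>n\<close> are therefore the elements of \<open>topspace (Euclidean_space n)\<close>, i.e. the
  functions \<open>nat \<Rightarrow> real\<close> vanishing at all arguments \<open>\<ge> n\<close>.
\<close>

definition edist :: "nat \<Rightarrow> (nat \<Rightarrow> real) \<Rightarrow> (nat \<Rightarrow> real) \<Rightarrow> real" where
  "edist n x y = L2_set (\<lambda>i. x i - y i) {..<n}"

text \<open>As for the library's \<^const>\<open>diameter\<close>, the empty set has diameter \<open>0\<close>.\<close>

definition ediam :: "nat \<Rightarrow> (nat \<Rightarrow> real) set \<Rightarrow> real" where
  "ediam n P = (if P = {} then 0 else SUP (x, y) \<in> P \<times> P. edist n x y)"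

definition congruent_to :: "'a::euclidean_space set \<Rightarrow> nat \<Rightarrow> (nat \<Rightarrow> real) set \<Rightarrow> bool" where
  "congruent_to A n A' \<longleftrightarrow>
     (\<exists>f. bij_betw f A A' \<and> (\<forall>x\<in>A. \<forall>y\<in>A. edist n (f x) (f y) = dist x y))"

definition diameter_ramsey :: "'a::euclidean_space set \<Rightarrow> bool" where
  "diameter_ramsey A \<longleftrightarrow>
     finite A \<and>
     (\<forall>r::nat. r \<ge> 1 \<longrightarrow>
       (\<exists>n B. n \<ge> 1 \<and> B \<subseteq> topspace (Euclidean_space n) \<and> finite B \<and> ediam n B = diameter A \<and>
         (\<forall>col::(nat \<Rightarrow> real) \<Rightarrow> nat. col ` B \<subseteq> {..<r} \<longrightarrow>
           (\<exists>A'\<subseteq>B. (\<exists>c. \<forall>x\<in>A'. col x = c) \<and> congruent_to A n A'))))"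

text \<open>The angle at \<open>b\<close> in the triangle \<open>abc\<close>, in radians; meaningful only if \<open>a \<noteq> b\<close> and \<open>c \<noteq> b\<close>.\<close>

definition angle_at :: "'a::euclidean_space \<Rightarrow> 'a \<Rightarrow> 'a \<Rightarrow> real" where
  "angle_at a b c = arccos (((a - b) \<bullet> (c - b)) / (norm (a - b) * norm (c - b)))"

end

theory Submission
  imports Defs
begin

text \<open>
  The circumradius \<open>R\<close> of a triangle with longest side \<open>d\<close> and an angle above 135 degrees satisfies
  \<open>R > d / \<surd>2\<close>. By Jung's theorem, a set \<open>B\<close> of diameter \<open>d\<close> lies, in every dimension, in a ball whose
  radius is at most \<open>d / \<surd>2\<close>. Cut this ball into thin concentric shells and colour \<open>B\<close> accordingly;
  the number of shells does not depend on the dimension. The vertices of a monochromatic copy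
  of the triangle are almost equidistant from the centre of the ball, so the projection of the centre
  to the plane of the copy is close to its circumcentre. Hence the distance of the vertices from
  the centre is almost \<open>R\<close> or larger, which is impossible.
\<close>

section \<open>The inner product on coordinate functions\<close>

definition ip :: "nat \<Rightarrow> (nat \<Rightarrow> real) \<Rightarrow> (nat \<Rightarrow> real) \<Rightarrow> real" where
  "ip n x y = (\<Sum>i<n. x i * y i)"

lemma ip_commute: "ip n x y = ip n y x"
  by (simp add: ip_def mult.commute)

lemma ip_nonneg: "0 \<le> ip n x x"
  by (simp add: ip_def sum_nonneg)

lemma ip_add_left: "ip n (\<lambda>i. x i + y i) z = ip n x z + ip n y z"
  by (simp add: ip_def sum.distrib distrib_right)

lemma ip_diff_left: "ip n (\<lambda>i. x i - y i) z = ip n x z - ip n y z"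
  by (simp add: ip_def sum_subtractf left_diff_distrib)

lemma ip_scale_left: "ip n (\<lambda>i. e * x i) z = e * ip n x z"
  by (simp add: ip_def sum_distrib_left mult.assoc)

lemma ip_add_right: "ip n z (\<lambda>i. x i + y i) = ip n z x + ip n z y"
  using ip_add_left ip_commute by metis

lemma ip_diff_right: "ip n z (\<lambda>i. x i - y i) = ip n z x - ip n z y"
  using ip_diff_left ip_commute by metis

lemma ip_scale_right: "ip n z (\<lambda>i. e * x i) = e * ip n z x"
  using ip_scale_left ip_commute by metis

lemmas ip_linear = ip_add_left ip_diff_left ip_scale_left ip_add_right ip_diff_right ip_scale_right

lemma edist_square: "(edist n x y)\<^sup>2 = ip n x x - 2 * ip n x y + ip n y y"
proof -
  have "(edist n x y)\<^sup>2 = ip n (\<lambda>i. x i - y i) (\<lambda>i. x i - y i)"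
    by (simp add: edist_def L2_set_def sum_nonneg ip_def power2_eq_square)
  then show ?thesis
    by (simp add: ip_linear ip_commute[of n y x])
qed

lemma edist_nonneg: "0 \<le> edist n x y"
  by (simp add: edist_def L2_set_nonneg)

section \<open>A dimension-free form of Jung's theorem\<close>

text \<open>
  The convex hull of the points \<open>(x, |x|\<^sup>2)\<close> with \<open>x \<in> B\<close>. On it, \<open>t - |y|\<^sup>2\<close> is at most half the
  squared diameter of \<open>B\<close>, and a near-maximiser \<open>y\<close> of this quantity is the centre of a small
  enclosing ball.
\<close>

inductive lifted_hull :: "nat \<Rightarrow> (nat \<Rightarrow> real) set \<Rightarrow> (nat \<Rightarrow> real) \<Rightarrow> real \<Rightarrow> bool" for n B where
  base: "x \<in> B \<Longrightarrow> lifted_hull n B x (ip n x x)"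
| step: "\<lbrakk>lifted_hull n B y s; lifted_hull n B z t; 0 \<le> e; e \<le> 1\<rbrakk> \<Longrightarrow>
    lifted_hull n B (\<lambda>i. (1 - e) * y i + e * z i) ((1 - e) * s + e * t)"

text \<open>The squared norm is convex: a combination falls short by exactly
  \<open>(1 - e) * e\<close> times the squared distance of \<open>y\<close> and
  \<open>z\<close>.\<close>

lemma lifted_hull_above_paraboloid:
  assumes "lifted_hull n B y t"
  shows "ip n y y \<le> t"
  using assms
proof induction
  case (step y s z t e)
  have "(1 - e) * ip n y y + e * ip n z z - ip n (\<lambda>i. (1 - e) * y i + e * z i) (\<lambda>i. (1 - e) * y i + e * z i)
      = (1 - e) * e * ip n (\<lambda>i. y i - z i) (\<lambda>i. y i - z i)"
    by (simp add: ip_linear ip_commute[of n z y] algebra_simps power2_eq_square)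
  moreover have "0 \<le> (1 - e) * e * ip n (\<lambda>i. y i - z i) (\<lambda>i. y i - z i)"
    using step ip_nonneg by simp
  moreover have "(1 - e) * ip n y y + e * ip n z z \<le> (1 - e) * s + e * t"
    using step by (intro add_mono mult_left_mono) auto
  ultimately show ?case by linarith
qed simp

text \<open>Affine bounds survive convex combinations; this carries distance bounds from
  \<open>B\<close> to the hull.\<close>

lemma lifted_hull_affine_le:
  assumes "lifted_hull n B y t" and "\<And>x. x \<in> B \<Longrightarrow> ip n x x - 2 * ip n x v \<le> k"
  shows "t - 2 * ip n y v \<le> k"
  using assms(1)
proof induction
  case (step y s z t e)
  have "(1 - e) * (s - 2 * ip n y v) + e * (t - 2 * ip n z v) \<le> (1 - e) * k + e * k"
    using step by (intro add_mono mult_left_mono) auto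
  then show ?case
    by (simp add: ip_linear algebra_simps)
qed (simp add: assms(2))

lemma jung_approx:
  assumes "B \<noteq> {}" and diam: "\<And>x y. \<lbrakk>x \<in> B; y \<in> B\<rbrakk> \<Longrightarrow> (edist n x y)\<^sup>2 \<le> D" and "\<epsilon> > 0"
  shows "\<exists>c. \<forall>x\<in>B. (edist n x c)\<^sup>2 \<le> D / 2 + \<epsilon>"
proof -
  have D: "0 \<le> D"
    using assms(1) diam zero_le_power2 order_trans by (metis ex_in_conv)
  have point: "t - 2 * ip n y x \<le> D - ip n x x" if "lifted_hull n B y t" "x \<in> B" for y t x
  proof (rule lifted_hull_affine_le[OF that(1)])
    fix u assume "u \<in> B"
    with diam[OF this that(2)] show "ip n u u - 2 * ip n u x \<le> D - ip n x x"
      by (simp add: edist_square)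
  qed
  \<comment> \<open>The affine bound again, in the other argument. For equal points it says
    \<open>2 * (t - ip n y y) \<le> D\<close>.\<close>
  have pair: "t - 2 * ip n y z \<le> D - s" if "lifted_hull n B y t" "lifted_hull n B z s" for y t z s
  proof (rule lifted_hull_affine_le[OF that(1)])
    fix u assume "u \<in> B"
    with point[OF that(2) this] show "ip n u u - 2 * ip n u z \<le> D - s"
      by (simp add: ip_commute[of n u z])
  qed
  define H where "H = {t - ip n y y | y t. lifted_hull n B y t}"
  have H_le: "h \<le> D / 2" if "h \<in> H" for h
    using that pair by (fastforce simp: H_def)
  have "H \<noteq> {}"
    using \<open>B \<noteq> {}\<close> lifted_hull.base by (fastforce simp: H_def)
  have bdd: "bdd_above H"
    using H_le by (rule bdd_aboveI)
  define e where "e = min 1 (\<epsilon> / (2 * (D + 1)))"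
  have e: "0 < e" "e \<le> 1" "e * D \<le> \<epsilon> / 2"
  proof -
    show "0 < e" "e \<le> 1" using D \<open>\<epsilon> > 0\<close> by (auto simp: e_def)
    have "e \<le> \<epsilon> / (2 * (D + 1))" by (simp add: e_def)
    moreover have "0 < 2 * (D + 1)" using D by simp
    ultimately have "e * (2 * (D + 1)) \<le> \<epsilon>" by (simp only: pos_le_divide_eq)
    moreover have "e * (2 * (D + 1)) = 2 * (e * D) + 2 * e" by (simp add: distrib_left)
    ultimately show "e * D \<le> \<epsilon> / 2" using \<open>0 < e\<close> by linarith
  qed
  \<comment> \<open>The slack carries a factor \<open>e\<close>, to be cancelled after moving a
    fraction \<open>e\<close> of the way.\<close>
  have "Sup H - e * \<epsilon> / 2 < Sup H" using e \<open>\<epsilon> > 0\<close> by simp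
  then obtain h where "h \<in> H" and h: "Sup H - e * \<epsilon> / 2 < h"
    using less_cSup_iff[OF \<open>H \<noteq> {}\<close> bdd] by blast
  then obtain c s where c: "lifted_hull n B c s" and hc: "h = s - ip n c c"
    by (auto simp: H_def)
  show ?thesis
  proof (intro exI ballI)
    fix x assume x: "x \<in> B"
    define u where "u = (edist n x c)\<^sup>2"
    have u: "u = ip n x x - 2 * ip n x c + ip n c c" by (simp add: u_def edist_square)
    have "u \<le> D"
      using point[OF c x] lifted_hull_above_paraboloid[OF c] by (simp add: u ip_commute[of n x c])
    \<comment> \<open>Moving \<open>c\<close> towards \<open>x\<close> changes the gap
      \<open>h\<close> by \<open>e * (u - h) - e * (e * u)\<close>; near-maximality of
      \<open>h\<close> therefore bounds \<open>u\<close>.\<close>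
    define y where "y = (\<lambda>i. (1 - e) * c i + e * x i)"
    have "lifted_hull n B y ((1 - e) * s + e * ip n x x)"
      unfolding y_def using c x e by (intro lifted_hull.intros) auto
    then have "(1 - e) * s + e * ip n x x - ip n y y \<in> H" by (auto simp: H_def)
    then have "(1 - e) * s + e * ip n x x - ip n y y \<le> Sup H" using bdd by (rule cSup_upper)
    also have "\<dots> \<le> h + e * \<epsilon> / 2" using h by simp
    also have "(1 - e) * s + e * ip n x x - ip n y y = h + e * (u - h) - e * (e * u)"
      by (simp add: y_def ip_linear hc u ip_commute[of n c x] algebra_simps)
    finally have "e * (u - h - e * u) \<le> e * (\<epsilon> / 2)" by (simp add: algebra_simps)
    then have "u - h - e * u \<le> \<epsilon> / 2" using e(1) by simp
    moreover have "e * u \<le> \<epsilon> / 2" using \<open>u \<le> D\<close> e mult_left_mono[of u D e] by linarith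
    ultimately show "(edist n x c)\<^sup>2 \<le> D / 2 + \<epsilon>"
      using H_le[OF \<open>h \<in> H\<close>] by (simp add: u_def)
  qed
qed

section \<open>Almost equidistant points\<close>

text \<open>
  For a triangle with edge vectors \<open>p\<close>, \<open>q\<close> of squared lengths \<open>A\<close>, \<open>C\<close> and inner product \<open>g\<close>,
  the vector \<open>\<alpha> p + \<beta> q\<close> points from the common vertex to the circumcentre.
\<close>

lemma circumcentre_bound:
  assumes p: "ip n p p = A" and q: "ip n q q = C" and pq: "ip n p q = g"
    and \<alpha>: "2 * (\<alpha> * A + \<beta> * g) = A" and \<beta>: "2 * (\<alpha> * g + \<beta> * C) = C"
    and wp: "\<bar>A - 2 * ip n w p\<bar> \<le> \<delta>" and wq: "\<bar>C - 2 * ip n w q\<bar> \<le> \<delta>"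
  shows "(\<alpha> * A + \<beta> * C) / 2 \<le> ip n w w + (\<bar>\<alpha>\<bar> + \<bar>\<beta>\<bar>) * \<delta>"
proof -
  define z where "z = (\<lambda>i. \<alpha> * p i + \<beta> * q i)"
  have "ip n z z = \<alpha> * (\<alpha> * A + \<beta> * g) + \<beta> * (\<alpha> * g + \<beta> * C)"
    by (simp add: z_def ip_linear p q pq ip_commute[of n q p] algebra_simps)
  also have "\<dots> = \<alpha> * (A / 2) + \<beta> * (C / 2)"
  proof -
    have "x = y / 2" if "2 * x = y" for x y :: real using that by simp
    then show ?thesis using \<alpha> \<beta> by metis
  qed
  finally have "ip n z z = (\<alpha> * A + \<beta> * C) / 2" by (simp add: field_simps)
  then have zz: "2 * ip n z z = \<alpha> * A + \<beta> * C" by simp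
  define X where "X = \<alpha> * (A - 2 * ip n w p)"
  define Y where "Y = \<beta> * (C - 2 * ip n w q)"
  have wz: "2 * ip n w z = \<alpha> * A + \<beta> * C - X - Y"
    by (simp add: z_def X_def Y_def ip_linear algebra_simps)
  have "x * y \<le> \<bar>x\<bar> * \<delta>" if "\<bar>y\<bar> \<le> \<delta>" for x y :: real
    using abs_ge_self[of "x * y"] mult_left_mono[OF that, of "\<bar>x\<bar>"] by (simp add: abs_mult)
  from this[OF wp] this[OF wq] have "X \<le> \<bar>\<alpha>\<bar> * \<delta>" "Y \<le> \<bar>\<beta>\<bar> * \<delta>"
    unfolding X_def Y_def .
  \<comment> \<open>The squared norm of \<open>w - z\<close>: since \<open>w\<close> has almost the
    same inner product with \<open>z\<close> as \<open>z\<close> itself, it cannot be much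
    shorter.\<close>
  moreover have "0 \<le> ip n w w - 2 * ip n w z + ip n z z"
    using ip_nonneg[of n "\<lambda>i. w i - z i"] by (simp add: ip_linear ip_commute[of n z w])
  ultimately show ?thesis
    using zz wz unfolding distrib_right by (simp add: field_simps)
qed

section \<open>Shell colouring of a set of given diameter\<close>

lemma edist_le_ediam:
  assumes "finite B" "x \<in> B" "y \<in> B"
  shows "edist n x y \<le> ediam n B"
proof -
  have "(\<lambda>(x, y). edist n x y) (x, y) \<le> (SUP (x, y) \<in> B \<times> B. edist n x y)"
    by (rule cSUP_upper) (use assms in auto)
  then show ?thesis using assms by (auto simp: ediam_def)
qed

text \<open>The hypothesis \<open>obtuse\<close> says that \<open>cos\<^sup>2 > 1/2\<close> holds for the angle at \<open>b\<close>.\<close>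

lemma not_diameter_ramsey_obtuse:
  fixes a b c :: "'a::euclidean_space"
  defines "A \<equiv> (dist a b)\<^sup>2" and "C \<equiv> (dist c b)\<^sup>2" and "g \<equiv> (a - b) \<bullet> (c - b)"
  assumes neg: "g < 0" and obtuse: "A * C < 2 * g\<^sup>2" and nondeg: "g\<^sup>2 < A * C"
  shows "\<not> diameter_ramsey {a, b, c}"
proof
  assume ramsey: "diameter_ramsey {a, b, c}"
  define D where "D = (dist a c)\<^sup>2"
  have D: "D = A + C - 2 * g"
    by (simp add: D_def A_def C_def g_def dist_norm power2_norm_eq_inner inner_simps inner_commute)
  have AC: "0 \<le> A" "0 \<le> C" by (auto simp: A_def C_def)
  then have "D > 0" using D neg by simp
  have "A \<le> D" "C \<le> D" using D AC neg by auto
  then have "dist a b \<le> dist a c" "dist c b \<le> dist a c"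
    by (auto simp: A_def C_def D_def)
  then have diam: "diameter {a, b, c} \<le> dist a c"
    by (intro diameter_le) (auto simp: dist_norm norm_minus_commute)
  \<comment> \<open>The Gram determinant, four times the squared area; \<alpha> and \<beta> come
    from Cramer's rule.\<close>
  define K where "K = A * C - g\<^sup>2"
  have "K > 0" using nondeg by (simp add: K_def)
  define \<alpha> where "\<alpha> = C * (A - g) / (2 * K)"
  define \<beta> where "\<beta> = A * (C - g) / (2 * K)"
  have "C * (A - g) * A + A * (C - g) * g = A * K" "C * (A - g) * g + A * (C - g) * C = C * K"
    by (simp_all add: K_def algebra_simps power2_eq_square)
  then have \<alpha>\<beta>: "2 * (\<alpha> * A + \<beta> * g) = A" "2 * (\<alpha> * g + \<beta> * C) = C"
    using \<open>K > 0\<close> by (simp_all add: \<alpha>_def \<beta>_def field_simps)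
  \<comment> \<open>The excess of the squared circumradius over \<open>D / 2\<close>, positive
    because \<open>obtuse\<close> says \<open>2 * K < A * C\<close>.\<close>
  define \<kappa> where "\<kappa> = (\<alpha> * A + \<beta> * C) / 2 - D / 2"
  have "(\<alpha> * A + \<beta> * C) / 2 = A * C * D / (4 * K)"
    using \<open>K > 0\<close> by (simp add: \<alpha>_def \<beta>_def D field_simps)
  moreover have "D / 2 < A * C * D / (4 * K)"
  proof -
    have "2 * K * D < A * C * D"
      using obtuse \<open>D > 0\<close> by (intro mult_strict_right_mono) (auto simp: K_def)
    then show ?thesis using \<open>K > 0\<close> by (simp add: field_simps)
  qed
  ultimately have "\<kappa> > 0" by (simp add: \<kappa>_def)
  define M where "M = \<bar>\<alpha>\<bar> + \<bar>\<beta>\<bar>"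
  define \<delta> where "\<delta> = \<kappa> / (4 * (M + 1))"
  have "M \<ge> 0" by (simp add: M_def)
  have "\<delta> > 0" using \<open>\<kappa> > 0\<close> \<open>M \<ge> 0\<close> by (simp add: \<delta>_def)
  have M\<delta>: "M * \<delta> < \<kappa> / 2"
    using \<open>\<kappa> > 0\<close> \<open>M \<ge> 0\<close> by (simp add: \<delta>_def field_simps add_pos_nonneg)
  \<comment> \<open>Shell indices start at 0, hence the \<open>+ 1\<close>. The count depends on the
    triangle only, so it is fixed before \<open>n\<close> and \<open>B\<close>.\<close>
  define r where "r = nat \<lfloor>(D / 2 + \<kappa> / 2) / \<delta>\<rfloor> + 1"
  have "r \<ge> 1" by (simp add: r_def)
  with ramsey obtain n B where B: "finite B" "ediam n B = diameter {a, b, c}"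
    and mono: "\<And>col::(nat \<Rightarrow> real) \<Rightarrow> nat. col ` B \<subseteq> {..<r} \<Longrightarrow>
      \<exists>A'\<subseteq>B. (\<exists>k. \<forall>x\<in>A'. col x = k) \<and> congruent_to {a, b, c} n A'"
    unfolding diameter_ramsey_def by metis
  have "B \<noteq> {}"
  proof
    assume "B = {}"
    with mono[of "\<lambda>_. 0"] show False by (auto simp: congruent_to_def bij_betw_def)
  qed
  have "(edist n x y)\<^sup>2 \<le> D" if "x \<in> B" "y \<in> B" for x y
  proof -
    have "edist n x y \<le> dist a c"
      using edist_le_ediam[OF B(1) that, of n] B(2) diam by linarith
    then show ?thesis unfolding D_def using edist_nonneg by (rule power_mono)
  qed
  from jung_approx[OF \<open>B \<noteq> {}\<close> this, where \<epsilon> = "\<kappa> / 2"] obtain m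
    where m: "\<And>x. x \<in> B \<Longrightarrow> (edist n x m)\<^sup>2 \<le> D / 2 + \<kappa> / 2"
    using \<open>\<kappa> > 0\<close> by auto
  define col where "col x = nat \<lfloor>(edist n x m)\<^sup>2 / \<delta>\<rfloor>" for x
  have "col ` B \<subseteq> {..<r}"
  proof (clarsimp simp: col_def r_def less_Suc_eq_le)
    fix x assume "x \<in> B"
    then show "nat \<lfloor>(edist n x m)\<^sup>2 / \<delta>\<rfloor> \<le> nat \<lfloor>(D / 2 + \<kappa> / 2) / \<delta>\<rfloor>"
      using m \<open>\<delta> > 0\<close> by (intro nat_mono floor_mono divide_right_mono) auto
  qed
  from mono[OF this] obtain A' k f where A': "A' \<subseteq> B" and k: "\<And>x. x \<in> A' \<Longrightarrow> col x = k"
    and f: "bij_betw f {a, b, c} A'"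
    and iso: "\<And>x y. \<lbrakk>x \<in> {a, b, c}; y \<in> {a, b, c}\<rbrakk> \<Longrightarrow> edist n (f x) (f y) = dist x y"
    unfolding congruent_to_def by metis
  have fA': "f a \<in> A'" "f b \<in> A'" "f c \<in> A'" using f by (auto simp: bij_betw_def)
  have shell: "\<bar>(edist n x m)\<^sup>2 - (edist n y m)\<^sup>2\<bar> \<le> \<delta>" if "x \<in> A'" "y \<in> A'" for x y
  proof -
    have "\<lfloor>(edist n x m)\<^sup>2 / \<delta>\<rfloor> = \<lfloor>(edist n y m)\<^sup>2 / \<delta>\<rfloor>"
      using k[OF that(1)] k[OF that(2)] \<open>\<delta> > 0\<close> by (simp add: col_def nat_eq_iff)
    then have "\<bar>(edist n x m)\<^sup>2 / \<delta> - (edist n y m)\<^sup>2 / \<delta>\<bar> \<le> 1" by linarith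
    then have "\<bar>((edist n x m)\<^sup>2 - (edist n y m)\<^sup>2) / \<delta>\<bar> \<le> 1" by (simp add: diff_divide_distrib)
    then show ?thesis using \<open>\<delta> > 0\<close> by (simp add: abs_divide)
  qed
  define p where "p = (\<lambda>i. f a i - f b i)"
  define q where "q = (\<lambda>i. f c i - f b i)"
  define w where "w = (\<lambda>i. m i - f b i)"
  note expand = ip_linear p_def q_def w_def edist_square
    ip_commute[of n "f b" "f a"] ip_commute[of n "f c" "f a"] ip_commute[of n "f c" "f b"]
    ip_commute[of n m "f a"] ip_commute[of n m "f b"] ip_commute[of n m "f c"]
  have sides: "(edist n (f a) (f b))\<^sup>2 = A" "(edist n (f c) (f b))\<^sup>2 = C" "(edist n (f a) (f c))\<^sup>2 = D"
    by (simp_all add: iso A_def C_def D_def)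
  have "ip n p p = A" "ip n q q = C" "ip n p q = g"
    using sides D by (simp_all add: expand)
  \<comment> \<open>The left side compares the squared distances of \<open>f a\<close> and
    \<open>f b\<close> from \<open>m\<close>.\<close>
  moreover have "\<bar>A - 2 * ip n w p\<bar> \<le> \<delta>"
    using shell[OF fA'(1) fA'(2)] sides(1) by (simp add: expand algebra_simps)
  moreover have "\<bar>C - 2 * ip n w q\<bar> \<le> \<delta>"
    using shell[OF fA'(3) fA'(2)] sides(2) by (simp add: expand algebra_simps)
  ultimately have "(\<alpha> * A + \<beta> * C) / 2 \<le> ip n w w + M * \<delta>"
    using circumcentre_bound \<alpha>\<beta> unfolding M_def by blast
  moreover have "ip n w w \<le> D / 2 + \<kappa> / 2"
    using m[of "f b"] fA' A' by (auto simp: expand)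
  moreover have "(\<alpha> * A + \<beta> * C) / 2 = D / 2 + \<kappa>" by (simp add: \<kappa>_def)
  \<comment> \<open>Jung's slack is \<kappa> / 2 and the shell error is smaller than that, so
    together they stay below \<kappa>.\<close>
  ultimately show False
    using M\<delta> by simp
qed

theorem corollary1p3:
  fixes a b c :: "real^2" and T :: "(real^2) set"
  assumes "T = {a, b, c}"
    and "\<not> collinear {a, b, c}"
    and "angle_at a b c > 3 * pi / 4"
  shows "\<not> diameter_ramsey T"
proof -
  define p where "p = a - b"
  define q where "q = c - b"
  have "\<not> collinear {0, p, q}"
    using assms(2) collinear_3[of a b c] by (simp add: p_def q_def insert_commute)
  \<comment> \<open>Equality in Cauchy-Schwarz would force collinearity.\<close>
  then have less: "\<bar>p \<bullet> q\<bar> < norm p * norm q"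
    using Cauchy_Schwarz_ineq2[of p q] by (simp add: norm_cauchy_schwarz_equal[symmetric] less_le)
  then have pos: "0 < norm p * norm q" by linarith
  define x where "x = p \<bullet> q / (norm p * norm q)"
  have x: "-1 \<le> x" "x \<le> 1"
    using less pos by (auto simp: x_def field_simps)
  have "arccos x > 3 * pi / 4" using assms(3) by (simp add: angle_at_def x_def p_def q_def)
  then have "cos (arccos x) < cos (3 * pi / 4)"
    using x arccos_bounded[of x] by (intro cos_monotone_0_pi) auto
  moreover have "cos (3 * pi / 4) = - (sqrt 2 / 2)"
    using cos_pi_minus[of "pi / 4"] by (simp add: cos_45 field_simps)
  ultimately have x_less: "x < - (sqrt 2 / 2)" using x by (simp add: cos_arccos)
  \<comment> \<open>After negation both sides are nonnegative, so squaring yields the condition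
    \<open>obtuse\<close>.\<close>
  then have "(sqrt 2 / 2)\<^sup>2 < (- x)\<^sup>2" by (intro power_strict_mono) auto
  then have "1 < 2 * x\<^sup>2" by (simp add: power_divide)
  then have "1 * (norm p * norm q)\<^sup>2 < 2 * x\<^sup>2 * (norm p * norm q)\<^sup>2"
    using pos by (intro mult_strict_right_mono zero_less_power)
  moreover have "p \<bullet> q = x * (norm p * norm q)"
    using pos by (simp add: x_def)
  ultimately have "(norm p * norm q)\<^sup>2 < 2 * (p \<bullet> q)\<^sup>2"
    by (simp only: power_mult_distrib mult.assoc mult_1)
  moreover have "(p \<bullet> q)\<^sup>2 < (norm p * norm q)\<^sup>2"
    using less abs_le_square_iff[of "norm p * norm q" "p \<bullet> q"] by (simp flip: not_le)
  moreover have "p \<bullet> q < 0"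
  proof -
    have "x < 0" using x_less real_sqrt_gt_zero[of 2] by linarith
    then show ?thesis using pos by (simp add: x_def divide_less_0_iff)
  qed
  ultimately show ?thesis
    unfolding assms(1)
    by (intro not_diameter_ramsey_obtuse)
      (simp_all add: p_def q_def dist_norm power_mult_distrib)
qed

end
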